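(* Let $p$ be a prime. If $\phi,\psi \in C(\mathbb{Z}_p,\mathbb{C}_p)$, then $\mathscr{S}(\phi)\star\psi = \phi\star\mathscr{S}(\psi)$.
   Context: $C(\mathbb{Z}_p,\mathbb{C}_p)$ is the $\mathbb{C}_p$-vector space of continuous functions $\mathbb{Z}_p \to \mathbb{C}_p$, and $\mathscr{S} : C(\mathbb{Z}_p,\mathbb{C}_p)\to C(\mathbb{Z}_p,\mathbb{C}_p)$ is $\mathscr{S}(\phi)(x) = \phi(x) - x\phi(x-1)$. For $n\ge0$, $\beta_n(x) = \binom{x}{n}$; every $\phi \in C(\mathbb{Z}_p,\mathbb{C}_p)$ is uniquely $\sum_{n\ge0}a_n\beta_n$ with $a_n \in \mathbb{C}_p$, $a_n\to0$ (Mahler coefficients). The convolution product $\star$ on $C(\mathbb{Z}_p,\mathbb{C}_p)$ is defined as follows: if $\phi,\psi$ have Mahler coefficients $(a_k)_{k\ge0}$, $(b_l)_{l\ge0}$, then $$\phi\star\psi = \sum_{n=0}^\infty\left(\sum_{k=0}^n\binom{n}{k}a_kb_{n-k}\right)\beta_n .$$ *)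

theory Defs
  imports "HOL-Analysis.Analysis" "HOL-Computational_Algebra.Computational_Algebra"
begin

text \<open>
  Neither \<open>\<rat>\<^sub>p\<close> nor \<open>\<complex>\<^sub>p\<close> is available in the library. The field \<open>\<complex>\<^sub>p\<close>, the completion of an
  algebraic closure of the completion \<open>\<rat>\<^sub>p\<close> of \<open>\<rat>\<close>, is determined only up to isometric
  isomorphism; a type \<open>'c\<close> is said here to be a copy of \<open>\<complex>\<^sub>p\<close> if it is such a field.
\<close>

text \<open>
  The library's \<open>norm\<close> is reserved for real normed vector spaces, so the absolute value is a
  separate class parameter. It is nonnegative and vanishes only at \<open>0\<close> because it induces the
  metric.
\<close>

class complete_ultrametric_field = field_char_0 + complete_space +
  fixes absval :: "'a \<Rightarrow> real"
  assumes dist_absval: "dist x y = absval (x - y)"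
    and absval_mult: "absval (x * y) = absval x * absval y"
    and absval_ultrametric: "absval (x + y) \<le> max (absval x) (absval y)"

text \<open>
  In a complete field whose absolute value restricts on \<open>\<rat>\<close> to the \<open>p\<close>-adic one, the completion of \<open>\<rat>\<close>
  is its closure. The prime \<open>p\<close> enters through the absolute value of the ambient type.
\<close>

definition Qp :: "'c::complete_ultrametric_field set" where
  "Qp = closure \<rat>"

definition Zp :: "'c::complete_ultrametric_field set" where
  "Zp = {x \<in> Qp. absval x \<le> 1}"

definition Qp_alg :: "'c::complete_ultrametric_field set" where
  "Qp_alg = {x. \<exists>f :: 'c poly. f \<noteq> 0 \<and> (\<forall>i. coeff f i \<in> Qp) \<and> poly f x = 0}"

text \<open>
  By multiplicativity and the ultrametric inequality, the first clause forces \<open>absval\<close> on \<open>\<rat>\<close> to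
  be the \<open>p\<close>-adic absolute value when \<open>p\<close> is prime. The second says that \<open>Qp_alg\<close>, which
  is algebraic over \<open>Qp\<close> by definition, is an algebraic closure of \<open>Qp\<close>. The third says
  that the (complete) ambient field is the completion of \<open>Qp_alg\<close>.
\<close>

definition is_Cp :: "nat \<Rightarrow> 'c::complete_ultrametric_field itself \<Rightarrow> bool" where
  "is_Cp p (_ :: 'c itself) \<longleftrightarrow>
     absval (of_nat p :: 'c) = 1 / real p \<and>
     (\<forall>f :: 'c poly. degree f > 0 \<and> (\<forall>i. coeff f i \<in> Qp_alg) \<longrightarrow> (\<exists>x\<in>Qp_alg. poly f x = 0)) \<and>
     closure (Qp_alg :: 'c set) = UNIV"

text \<open>
  A function on \<open>Zp\<close> is represented by its extension by \<open>undefined\<close> outside \<open>Zp\<close>, so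
  that equality of such functions is equality on \<open>Zp\<close>.
\<close>

definition C_Zp :: "('c::complete_ultrametric_field \<Rightarrow> 'c) set" where
  "C_Zp = {\<phi> \<in> extensional Zp. continuous_on Zp \<phi>}"

definition S_op :: "('c::complete_ultrametric_field \<Rightarrow> 'c) \<Rightarrow> 'c \<Rightarrow> 'c" where
  "S_op \<phi> = (\<lambda>x\<in>Zp. \<phi> x - x * \<phi> (x - 1))"

definition mahler_basis :: "nat \<Rightarrow> 'c::complete_ultrametric_field \<Rightarrow> 'c" where
  "mahler_basis n x = x gchoose n"

definition mahler_coeffs :: "('c::complete_ultrametric_field \<Rightarrow> 'c) \<Rightarrow> nat \<Rightarrow> 'c" where
  "mahler_coeffs \<phi> =
     (THE a. a \<longlonglongrightarrow> 0 \<and> (\<forall>x\<in>Zp. (\<lambda>n. a n * mahler_basis n x) sums \<phi> x))"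

definition convolution ::
    "('c::complete_ultrametric_field \<Rightarrow> 'c) \<Rightarrow> ('c \<Rightarrow> 'c) \<Rightarrow> 'c \<Rightarrow> 'c" (infixl "\<star>" 70) where
  "\<phi> \<star> \<psi> = (\<lambda>x\<in>Zp. \<Sum>n.
     (\<Sum>k\<le>n. of_nat (n choose k) * mahler_coeffs \<phi> k * mahler_coeffs \<psi> (n - k)) * mahler_basis n x)"

end

theory Submission
  imports Defs "HOL-Number_Theory.Cong"
begin

text \<open>
  In Mahler coordinates the theorem is an identity between finite sums. Since
  \<open>x (x - 1 choose n) = (n + 1) (x choose n + 1)\<close>, the operator \<open>S_op\<close> turns a coefficient sequence
  \<open>a\<close> into \<open>a - T a\<close> with \<open>(T a) n = n * a (n - 1)\<close> (\<open>mahler_expansion_S_op\<close>). If coefficient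
  sequences are read as exponential generating functions, then \<open>T\<close> is multiplication by the variable
  and the convolution is multiplication of series. Hence \<open>S_op\<close> is multiplication by
  \<open>1 - X\<close>, which may be moved from one factor to the other
  (\<open>binomial_convolution_S_op_coeffs\<close>).

  The analytic content is that coefficients exist at all: \<open>mahler_coeffs\<close> is a definite description,
  which says nothing about a function without a unique expansion. So Mahler's theorem
  (\<open>mahler_theorem\<close>) is proved first, by Bojanic's argument. By compactness of \<open>Zp\<close>, a continuous
  function restricted to the natural numbers is a bounded sequence that is almost periodic: for every
  error bound, some \<open>p ^ t\<close> is a period up to that error. As \<open>p\<close> divides the inner binomial coefficients of \<open>p ^ t\<close>, every
  \<open>p ^ t\<close> further differences shrink the sequence by the factor \<open>1 / p\<close>, up to the
  given error; so the iterated differences at \<open>0\<close> tend to \<open>0\<close>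
  (\<open>fwd_diff_funpow_tendsto_0\<close>). Newton's formula shows that the series with these
  coefficients has the right values on the natural numbers, and by density
  (\<open>Zp_near_of_nat\<close>) it has them on all of \<open>Zp\<close>.
\<close>

section \<open>Ultrametric fields\<close>

lemma absval_0 [simp]: "absval (0 :: 'c::complete_ultrametric_field) = 0"
  using dist_absval[of "0::'c" 0] by simp

lemma absval_eq_0_iff [simp]: "absval x = 0 \<longleftrightarrow> (x :: 'c::complete_ultrametric_field) = 0"
  by (metis diff_0_right dist_absval dist_eq_0_iff)

lemma absval_nonneg [simp]: "absval (x :: 'c::complete_ultrametric_field) \<ge> 0"
  using dist_absval[of x 0] zero_le_dist[of x 0] by simp

lemma absval_1 [simp]: "absval (1 :: 'c::complete_ultrametric_field) = 1"
  using absval_mult[of "1::'c" 1] by simp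

lemma absval_minus [simp]: "absval (- x) = absval (x :: 'c::complete_ultrametric_field)"
  using dist_absval[of 0 x] dist_absval[of x 0] by (simp add: dist_commute)

lemma absval_minus_commute: "absval (x - y) = absval (y - x :: 'c::complete_ultrametric_field)"
  by (metis absval_minus minus_diff_eq)

lemma absval_add_le:
  fixes x y :: "'c::complete_ultrametric_field"
  assumes "absval x \<le> e" "absval y \<le> e"
  shows "absval (x + y) \<le> e"
  using absval_ultrametric[of x y] assms by linarith

lemma absval_diff_le:
  fixes x y :: "'c::complete_ultrametric_field"
  assumes "absval x \<le> e" "absval y \<le> e"
  shows "absval (x - y) \<le> e"
  using absval_add_le[of x e "- y"] assms by simp

lemma absval_sum_le:
  fixes f :: "'b \<Rightarrow> 'c::complete_ultrametric_field"
  assumes "0 \<le> e" "\<And>i. i \<in> A \<Longrightarrow> absval (f i) \<le> e"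
  shows "absval (sum f A) \<le> e"
  using assms(2) by (induction A rule: infinite_finite_induct) (auto intro: absval_add_le simp: assms(1))

lemma absval_of_nat_le_1: "absval (of_nat n :: 'c::complete_ultrametric_field) \<le> 1"
  by (induction n) (auto intro: absval_add_le)

lemma absval_of_int_le_1: "absval (of_int n :: 'c::complete_ultrametric_field) \<le> 1"
  by (cases n rule: int_cases2) (auto simp: absval_of_nat_le_1)

lemma absval_mult_le:
  fixes x y :: "'c::complete_ultrametric_field"
  assumes "absval x \<le> 1" "absval y \<le> e"
  shows "absval (x * y) \<le> e"
  using mult_mono[OF assms] by (simp add: absval_mult)

lemma absval_power: "absval (x ^ n) = absval (x :: 'c::complete_ultrametric_field) ^ n"
  by (induction n) (auto simp: absval_mult)

lemma tendsto_absval_iff: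
  fixes f :: "'b \<Rightarrow> 'c::complete_ultrametric_field"
  shows "(f \<longlongrightarrow> l) F \<longleftrightarrow> ((\<lambda>x. absval (f x - l)) \<longlongrightarrow> 0) F"
  by (subst tendsto_dist_iff) (simp add: dist_absval)

lemma tendsto_zero_absval_iff:
  fixes a :: "nat \<Rightarrow> 'c::complete_ultrametric_field"
  shows "a \<longlonglongrightarrow> 0 \<longleftrightarrow> (\<forall>e>0. \<exists>N. \<forall>n\<ge>N. absval (a n) \<le> e)"
proof -
  have "a \<longlonglongrightarrow> 0 \<longleftrightarrow> (\<forall>e>0. \<exists>N. \<forall>n\<ge>N. absval (a n) < e)"
    by (simp add: lim_sequentially dist_absval)
  also have "\<dots> \<longleftrightarrow> (\<forall>e>0. \<exists>N. \<forall>n\<ge>N. absval (a n) \<le> e)"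
    by (meson dense less_le_trans order_le_less_trans less_imp_le)
  finally show ?thesis .
qed

text \<open>
  Addition and multiplication are continuous for the metric of \<open>absval\<close>; stated as class inclusions,
  this makes the general rules for limits and series apply to ultrametric fields.
\<close>

instance complete_ultrametric_field \<subseteq> topological_ab_group_add
proof
  fix a b :: 'a
  have *: "((\<lambda>x. absval (fst x - a)) \<longlongrightarrow> 0) (nhds a \<times>\<^sub>F nhds b)"
          "((\<lambda>x. absval (snd x - b)) \<longlongrightarrow> 0) (nhds a \<times>\<^sub>F nhds b)"
    by (simp_all flip: tendsto_absval_iff add: filterlim_fst filterlim_snd)
  have "((\<lambda>x. absval (fst x + snd x - (a + b))) \<longlongrightarrow> 0) (nhds a \<times>\<^sub>F nhds b)"
  proof (rule tendsto_sandwich[OF _ _ tendsto_const tendsto_max[OF *, simplified]])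
    show "\<forall>\<^sub>F x in nhds a \<times>\<^sub>F nhds b.
        absval (fst x + snd x - (a + b)) \<le> max (absval (fst x - a)) (absval (snd x - b))"
      by (intro always_eventually allI) (metis absval_ultrametric add_diff_add)
  qed auto
  then show "((\<lambda>x. fst x + snd x) \<longlongrightarrow> a + b) (nhds a \<times>\<^sub>F nhds b)"
    by (simp add: tendsto_absval_iff)
next
  fix a :: 'a
  have "((\<lambda>x. absval (x - a)) \<longlongrightarrow> 0) (nhds a)"
    by (simp flip: tendsto_absval_iff add: filterlim_ident)
  moreover have "absval (- x - - a) = absval (x - a)" for x :: 'a
    by (metis absval_minus minus_diff_minus)
  ultimately show "(uminus \<longlongrightarrow> - a) (nhds a)"
    by (simp add: tendsto_absval_iff)
qed

instance complete_ultrametric_field \<subseteq> topological_comm_monoid_mult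
proof
  fix a b :: 'a
  have *: "((\<lambda>x. absval (fst x - a)) \<longlongrightarrow> 0) (nhds a \<times>\<^sub>F nhds b)"
          "((\<lambda>x. absval (snd x - b)) \<longlongrightarrow> 0) (nhds a \<times>\<^sub>F nhds b)"
    by (simp_all flip: tendsto_absval_iff add: filterlim_fst filterlim_snd)
  let ?h = "\<lambda>x. absval (fst x - a) * absval (snd x - b) + absval a * absval (snd x - b)
      + absval (fst x - a) * absval b"
  have "(?h \<longlongrightarrow> 0 * 0 + absval a * 0 + 0 * absval b) (nhds a \<times>\<^sub>F nhds b)"
    by (intro tendsto_intros *)
  then have h: "(?h \<longlongrightarrow> 0) (nhds a \<times>\<^sub>F nhds b)" by simp
  have "((\<lambda>x. absval (fst x * snd x - a * b)) \<longlongrightarrow> 0) (nhds a \<times>\<^sub>F nhds b)"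
  proof (rule tendsto_sandwich[OF _ _ tendsto_const h])
    have "absval (x * y - a * b) \<le> ?h (x, y)" for x y :: 'a
    proof -
      have "x * y - a * b = (x - a) * (y - b) + a * (y - b) + (x - a) * b"
        by (simp add: algebra_simps)
      then show ?thesis
        by (metis (no_types, lifting) absval_add_le absval_mult absval_nonneg add_increasing
            add_increasing2 fst_conv mult_nonneg_nonneg order_refl snd_conv)
    qed
    then show "\<forall>\<^sub>F x in nhds a \<times>\<^sub>F nhds b. absval (fst x * snd x - a * b) \<le> ?h x"
      by (intro always_eventually) auto
  qed auto
  then show "((\<lambda>x. fst x * snd x) \<longlongrightarrow> a * b) (nhds a \<times>\<^sub>F nhds b)"
    by (simp add: tendsto_absval_iff)
qed

lemma absval_limit_le:
  fixes f :: "nat \<Rightarrow> 'c::complete_ultrametric_field"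
  assumes "f \<longlonglongrightarrow> l" "\<And>n. absval (f n) \<le> e"
  shows "absval l \<le> e"
proof -
  have "closed (cball (0::'c) e)" by simp
  moreover have "f n \<in> cball 0 e" for n
    using assms(2)[of n] by (simp add: dist_absval)
  ultimately have "l \<in> cball 0 e"
    using assms(1) closed_sequentially by blast
  then show ?thesis by (simp add: dist_absval)
qed

section \<open>Iterated differences tend to zero\<close>

definition fwd_diff :: "(nat \<Rightarrow> 'a::ab_group_add) \<Rightarrow> nat \<Rightarrow> 'a" where
  "fwd_diff g n = g (Suc n) - g n"

text \<open>
  With \<open>E\<close> the shift, this is the binomial expansion of \<open>E ^ q = (1 + fwd_diff) ^ q\<close>. It serves twice:
  to bound \<open>fwd_diff ^^ q\<close> and to evaluate Mahler series at natural numbers.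
\<close>

lemma newton_forward_difference:
  fixes g :: "nat \<Rightarrow> 'a::comm_ring_1"
  shows "g (n + q) = (\<Sum>j\<le>q. of_nat (q choose j) * (fwd_diff ^^ j) g n)"
proof (induction q arbitrary: g)
  case (Suc q)
  have "(\<Sum>j\<le>Suc q. of_nat (Suc q choose j) * (fwd_diff ^^ j) g n)
      = g n + (\<Sum>j\<le>q. of_nat (q choose j) * (fwd_diff ^^ Suc j) g n)
        + (\<Sum>j\<le>q. of_nat (q choose Suc j) * (fwd_diff ^^ Suc j) g n)"
    by (subst sum.atMost_Suc_shift) (simp add: ring_distribs sum.distrib del: funpow.simps)
  also have "g n + (\<Sum>j\<le>q. of_nat (q choose j) * (fwd_diff ^^ Suc j) g n)
        + (\<Sum>j\<le>q. of_nat (q choose Suc j) * (fwd_diff ^^ Suc j) g n)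
      = (\<Sum>j\<le>Suc q. of_nat (q choose j) * (fwd_diff ^^ j) g n)
        + (\<Sum>j\<le>q. of_nat (q choose j) * (fwd_diff ^^ j) (fwd_diff g) n)"
    by (subst sum.atMost_Suc_shift) (simp add: funpow_Suc_right del: funpow.simps)
  also have "\<dots> = g (n + q) + fwd_diff g (n + q)"
    by (simp add: Suc.IH[of g] Suc.IH[of "fwd_diff g"] binomial_eq_0 del: funpow.simps)
  also have "\<dots> = g (n + Suc q)" by (simp add: fwd_diff_def)
  finally show ?case by (rule sym)
qed simp

lemma absval_fwd_diff_funpow_le:
  fixes g :: "nat \<Rightarrow> 'c::complete_ultrametric_field"
  assumes "\<And>n. absval (g n) \<le> M"
  shows "absval ((fwd_diff ^^ m) g n) \<le> M"
  by (induction m arbitrary: n) (auto simp: assms fwd_diff_def intro: absval_diff_le)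

lemma fwd_diff_funpow_almost_periodic:
  fixes g :: "nat \<Rightarrow> 'c::complete_ultrametric_field"
  assumes "\<And>n. absval (g (n + q) - g n) \<le> e"
  shows "absval ((fwd_diff ^^ m) g (n + q) - (fwd_diff ^^ m) g n) \<le> e"
proof (induction m arbitrary: n)
  case (Suc m)
  let ?h = "(fwd_diff ^^ m) g"
  have "fwd_diff ?h (n + q) - fwd_diff ?h n
      = (?h (Suc n + q) - ?h (Suc n)) - (?h (n + q) - ?h n)"
    by (simp add: fwd_diff_def)
  with Suc[of "Suc n"] Suc[of n] show ?case
    by (metis absval_diff_le funpow.simps(2) comp_apply)
qed (simp add: assms)

text \<open>
  In Newton's formula for \<open>g (n + q)\<close> the two outer terms are \<open>g n\<close> and the \<open>q\<close>-th difference. Solving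
  for the latter leaves the almost-periodicity error \<open>g (n + q) - g n\<close> and a sum whose binomial
  coefficients are small.
\<close>

lemma absval_fwd_diff_contract:
  fixes g :: "nat \<Rightarrow> 'c::complete_ultrametric_field"
  assumes "q > 0"
    and c: "\<And>j. 0 < j \<Longrightarrow> j < q \<Longrightarrow> absval (of_nat (q choose j) :: 'c) \<le> c" "0 \<le> c"
    and M: "\<And>n. absval (g n) \<le> M"
    and e: "\<And>n. absval (g (n + q) - g n) \<le> e"
  shows "absval ((fwd_diff ^^ q) g n) \<le> max e (c * M)"
proof -
  have "0 \<le> M" using M[of 0] absval_nonneg order_trans by blast
  have split: "{..q} = insert 0 (insert q {0<..<q})" using \<open>q > 0\<close> by auto
  have "g (n + q) = g n + (fwd_diff ^^ q) g n
      + (\<Sum>j\<in>{0<..<q}. of_nat (q choose j) * (fwd_diff ^^ j) g n)"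
    using \<open>q > 0\<close> by (simp add: newton_forward_difference[of g n q] split)
  then have eq: "(fwd_diff ^^ q) g n = (g (n + q) - g n)
      - (\<Sum>j\<in>{0<..<q}. of_nat (q choose j) * (fwd_diff ^^ j) g n)"
    by (simp add: algebra_simps)
  have "absval (\<Sum>j\<in>{0<..<q}. of_nat (q choose j) * (fwd_diff ^^ j) g n) \<le> c * M"
  proof (rule absval_sum_le)
    fix j assume "j \<in> {0<..<q}"
    then show "absval (of_nat (q choose j) * (fwd_diff ^^ j) g n) \<le> c * M"
      using c M by (auto simp: absval_mult intro!: mult_mono absval_fwd_diff_funpow_le)
  qed (use c \<open>0 \<le> M\<close> in simp)
  then show ?thesis
    unfolding eq using e[of n] by (intro absval_diff_le[of "_ - _"]) linarith+
qed

text \<open>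
  The absorption identity \<open>j * (q choose j) = q * (q - 1 choose j - 1)\<close> makes \<open>q = p ^ t\<close> a divisor of
  \<open>j * (q choose j)\<close>; if \<open>p\<close> did not divide the binomial coefficient, \<open>q\<close> would divide the
  smaller number \<open>j\<close>.
\<close>

lemma prime_dvd_prime_power_choose:
  assumes "prime (p::nat)" "0 < j" "j < p ^ t"
  shows "p dvd (p ^ t choose j)"
proof (rule ccontr)
  assume "\<not> p dvd (p ^ t choose j)"
  then have "coprime (p ^ t) (p ^ t choose j)"
    using assms(1) by (simp add: prime_imp_coprime)
  moreover have "j * (p ^ t choose j) = p ^ t * (p ^ t - 1 choose (j - 1))"
    using times_binomial_minus1_eq[OF assms(2)] by simp
  then have "p ^ t dvd j * (p ^ t choose j)" by simp
  ultimately have "p ^ t dvd j"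
    using coprime_dvd_mult_left_iff by blast
  then have "p ^ t \<le> j" using assms(2) by (rule dvd_imp_le)
  with assms(3) show False by simp
qed

lemma absval_of_nat_dvd_le:
  assumes "absval (of_nat p :: 'c::complete_ultrametric_field) = 1 / real p" "p dvd n"
  shows "absval (of_nat n :: 'c) \<le> 1 / real p"
proof -
  from assms(2) obtain k where "n = k * p" by (metis dvdE mult.commute)
  then show ?thesis
    using absval_mult_le[OF absval_of_nat_le_1[of k, where ?'c = 'c], of "of_nat p"] assms(1)
    by simp
qed

text \<open>
  Differences of \<open>g\<close> are almost periodic with the same period and the same error, so the contraction
  can be iterated with a fixed period \<open>p ^ t\<close>: after \<open>m\<close> rounds only \<open>max e (M / p ^ m)\<close> is left.
\<close>

lemma fwd_diff_funpow_tendsto_0: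
  fixes g :: "nat \<Rightarrow> 'c::complete_ultrametric_field"
  assumes p: "prime p" "absval (of_nat p :: 'c) = 1 / real p"
    and M: "\<And>n. absval (g n) \<le> M"
    and uc: "\<And>e. e > 0 \<Longrightarrow> \<exists>t. \<forall>n. absval (g (n + p ^ t) - g n) \<le> e"
  shows "(\<lambda>n. (fwd_diff ^^ n) g 0) \<longlonglongrightarrow> 0"
  unfolding tendsto_zero_absval_iff
proof (intro allI impI)
  fix e :: real assume "e > 0"
  then obtain t where t: "\<And>n. absval (g (n + p ^ t) - g n) \<le> e" using uc by blast
  define q where "q = p ^ t"
  have "p > 1" using p(1) prime_gt_1_nat by blast
  then have "q > 0" by (simp add: q_def)
  have iter: "absval ((fwd_diff ^^ (q * m)) g n) \<le> max e ((1 / real p) ^ m * M)" for m n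
  proof (induction m arbitrary: n)
    case (Suc m)
    have "absval ((fwd_diff ^^ q) ((fwd_diff ^^ (q * m)) g) n)
        \<le> max e (1 / real p * max e ((1 / real p) ^ m * M))"
    proof (rule absval_fwd_diff_contract[OF \<open>q > 0\<close>])
      show "absval (of_nat (q choose j) :: 'c) \<le> 1 / real p" if "0 < j" "j < q" for j
        using that prime_dvd_prime_power_choose[OF p(1)] absval_of_nat_dvd_le[OF p(2)]
        unfolding q_def by blast
      show "absval ((fwd_diff ^^ (q * m)) g (n + q) - (fwd_diff ^^ (q * m)) g n) \<le> e" for n
        using fwd_diff_funpow_almost_periodic[of g q e] t by (simp add: q_def)
    qed (use Suc in auto)
    moreover have "1 / real p * e \<le> e"
      using \<open>e > 0\<close> \<open>p > 1\<close> by (simp add: field_simps)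
    then have "1 / real p * max e ((1 / real p) ^ m * M) \<le> max e ((1 / real p) ^ Suc m * M)"
      by (auto simp: max_def)
    moreover have "(fwd_diff ^^ (q * Suc m)) g = (fwd_diff ^^ q) ((fwd_diff ^^ (q * m)) g)"
      by (simp add: funpow_add)
    ultimately show ?case unfolding le_max_iff_disj by (metis order_trans)
  qed (simp add: M le_max_iff_disj)
  have "(\<lambda>m. (1 / real p) ^ m * M) \<longlonglongrightarrow> 0 * M"
    using \<open>p > 1\<close> by (intro tendsto_mult tendsto_const LIMSEQ_power_zero) simp
  then have "eventually (\<lambda>m. (1 / real p) ^ m * M < e) sequentially"
    using \<open>e > 0\<close> by (intro order_tendstoD(2)) auto
  then obtain m where "(1 / real p) ^ m * M < e"
    by (auto simp: eventually_sequentially)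
  then have le: "absval ((fwd_diff ^^ (q * m)) g n) \<le> e" for n
    using iter[of m n] by linarith
  \<comment> \<open>Differences beyond a multiple of \<open>q\<close> cannot increase the bound.\<close>
  have "absval ((fwd_diff ^^ n) g 0) \<le> e" if "n \<ge> q * m" for n
  proof -
    have "(fwd_diff ^^ n) g = (fwd_diff ^^ (n - q * m)) ((fwd_diff ^^ (q * m)) g)"
      using that by (metis comp_apply funpow_add le_add_diff_inverse2)
    then show ?thesis using absval_fwd_diff_funpow_le[OF le] by simp
  qed
  then show "\<exists>N. \<forall>n\<ge>N. absval ((fwd_diff ^^ n) g 0) \<le> e" by blast
qed

section \<open>The ring of p-adic integers\<close>

lemma of_nat_in_Zp: "of_nat n \<in> (Zp :: 'c::complete_ultrametric_field set)"
  using closure_subset[of "\<rat> :: 'c set"] by (auto simp: Zp_def Qp_def absval_of_nat_le_1)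

lemma Zp_minus_1:
  assumes "x \<in> (Zp :: 'c::complete_ultrametric_field set)"
  shows "x - 1 \<in> Zp"
proof -
  have "x \<in> closure \<rat>" using assms by (simp add: Zp_def Qp_def)
  then obtain r where r: "\<forall>n. r n \<in> \<rat>" "r \<longlonglongrightarrow> x"
    unfolding closure_sequential by blast
  have "\<forall>n. r n - 1 \<in> \<rat>" using r(1) by simp
  moreover have "(\<lambda>n. r n - 1) \<longlonglongrightarrow> x - 1"
    by (rule tendsto_diff[OF r(2) tendsto_const])
  ultimately have "x - 1 \<in> Qp"
    unfolding Qp_def closure_sequential by (intro exI[of _ "\<lambda>n. r n - 1"]) simp
  moreover have "absval (x - 1) \<le> 1"
    using assms by (intro absval_diff_le) (simp_all add: Zp_def)
  ultimately show ?thesis by (simp add: Zp_def)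
qed

text \<open>
  In a Bezout relation \<open>u b + v p = 1\<close> the second term has absolute value below \<open>1\<close>, so the first one
  cannot.
\<close>

lemma absval_eq_1_if_coprime:
  fixes b :: int
  assumes "absval (of_nat p :: 'c::complete_ultrametric_field) = 1 / real p" "p > 1"
    and "coprime b (int p)"
  shows "absval (of_int b :: 'c) = 1"
proof -
  obtain u v where "u * b + v * int p = 1"
    using bezout_int[of b "int p"] assms(3) by auto
  then have "of_int u * of_int b + of_int v * of_nat p = (1 :: 'c)"
    by (metis of_int_1 of_int_add of_int_mult of_int_of_nat_eq)
  then have "1 \<le> max (absval (of_int u * of_int b :: 'c)) (absval (of_int v * of_nat p :: 'c))"
    by (metis absval_1 absval_ultrametric)
  moreover have "absval (of_int v * of_nat p :: 'c) \<le> 1 / real p"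
    using assms(1) by (intro absval_mult_le absval_of_int_le_1) auto
  moreover have "absval (of_int u * of_int b :: 'c) \<le> absval (of_int b :: 'c)"
    by (intro absval_mult_le absval_of_int_le_1) auto
  moreover have "1 / real p < 1" using assms(2) by simp
  ultimately have "1 \<le> absval (of_int b :: 'c)" by linarith
  then show ?thesis using absval_of_int_le_1[of b, where ?'c = 'c] by simp
qed

text \<open>
  In lowest terms the denominator of \<open>r\<close> is prime to \<open>p\<close>, as otherwise the numerator would be a unit and
  \<open>absval r > 1\<close>. The denominator is therefore invertible modulo \<open>p ^ k\<close>, and \<open>n\<close> is the residue of the
  fraction. The bound \<open>n < p ^ k\<close> is what gives total boundedness of \<open>Zp\<close>.
\<close>

lemma rat_near_of_nat:
  fixes r :: "'c::complete_ultrametric_field"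
  assumes p: "prime p" "absval (of_nat p :: 'c) = 1 / real p"
    and r: "r \<in> \<rat>" "absval r \<le> 1"
  shows "\<exists>n<p ^ k. absval (r - of_nat n) \<le> (1 / real p) ^ k"
proof -
  have "p > 1" using p(1) prime_gt_1_nat by blast
  obtain a b :: int where ab: "b > 0" "coprime a b" "r = of_int a / of_int b"
    using r(1) by (auto elim: Rats_cases')
  have ra: "absval r * absval (of_int b :: 'c) = absval (of_int a :: 'c)"
    using ab by (simp flip: absval_mult)
  have cop: "coprime b (int p)"
  proof (rule ccontr)
    assume "\<not> coprime b (int p)"
    then have "int p dvd b"
      using p(1) by (metis coprime_commute prime_imp_coprime prime_nat_int_transfer)
    then obtain c where c: "b = int p * c" by blast
    have "\<not> int p dvd a"
      using ab(2) \<open>int p dvd b\<close> p(1)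
      by (metis coprime_common_divisor not_prime_unit prime_nat_int_transfer)
    then have "absval (of_int a :: 'c) = 1"
      using p by (intro absval_eq_1_if_coprime[OF p(2) \<open>p > 1\<close>])
        (metis coprime_commute prime_imp_coprime prime_nat_int_transfer)
    moreover have "absval (of_int b :: 'c) \<le> 1 / real p"
      using c p(2) absval_mult_le[OF absval_of_int_le_1[of c, where ?'c = 'c], of "of_nat p"]
      by (simp add: mult.commute)
    then have "absval r * absval (of_int b :: 'c) \<le> 1 * (1 / real p)"
      using r(2) by (intro mult_mono) auto
    ultimately show False using ra \<open>p > 1\<close> by simp
  qed
  then have "coprime b (int p ^ k)" by simp
  then obtain u where u: "[b * u = 1] (mod int p ^ k)"
    using cong_solve_coprime_int by blast
  define n where "n = nat ((a * u) mod int p ^ k)"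
  have pk: "int p ^ k > 0" using \<open>p > 1\<close> by simp
  then have n: "int n = (a * u) mod int p ^ k" by (simp add: n_def)
  have "[b * int n = b * (a * u)] (mod int p ^ k)"
    unfolding n by (intro cong_mult) (auto simp: cong_def)
  also have "b * (a * u) = a * (b * u)" by simp
  also have "[a * (b * u) = a * 1] (mod int p ^ k)"
    by (intro cong_mult u cong_refl)
  finally have "int p ^ k dvd a - b * int n"
    by (simp add: cong_iff_dvd_diff dvd_diff_commute)
  then obtain d where d: "a - b * int n = int p ^ k * d" by blast
  have b1: "absval (of_int b :: 'c) = 1"
    using absval_eq_1_if_coprime[OF p(2) \<open>p > 1\<close> cop] .
  have "(r - of_nat n) * of_int b = of_int (a - b * int n)"
    using ab by (simp add: field_simps)
  also have "\<dots> = of_int d * of_nat p ^ k"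
    unfolding d by simp
  finally have "absval (r - of_nat n) = absval (of_int d * of_nat p ^ k :: 'c)"
    using b1 by (metis absval_mult mult.right_neutral)
  also have "\<dots> \<le> (1 / real p) ^ k"
    by (intro absval_mult_le absval_of_int_le_1) (simp add: absval_power p(2))
  finally have "absval (r - of_nat n) \<le> (1 / real p) ^ k" .
  moreover have "int n < int (p ^ k)" unfolding n using pk by simp
  ultimately show ?thesis by auto
qed

lemma Zp_near_of_nat:
  fixes x :: "'c::complete_ultrametric_field"
  assumes p: "prime p" "absval (of_nat p :: 'c) = 1 / real p"
    and x: "x \<in> Zp"
  shows "\<exists>n<p ^ k. absval (x - of_nat n) \<le> (1 / real p) ^ k"
proof -
  have "p > 1" using p(1) prime_gt_1_nat by blast
  then have pos: "(1 / real p) ^ k > 0" by simp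
  have le1: "(1 / real p) ^ k \<le> 1" using \<open>p > 1\<close> by (intro power_le_one) auto
  have "x \<in> closure \<rat>" using x by (simp add: Zp_def Qp_def)
  then obtain r where r: "r \<in> \<rat>" "dist r x < (1 / real p) ^ k"
    using pos closure_approachable by metis
  then have xr: "absval (x - r) \<le> (1 / real p) ^ k"
    by (simp add: dist_absval absval_minus_commute)
  then have "absval (x - (x - r)) \<le> 1"
    using x le1 by (intro absval_diff_le[of x _ "x - r"]) (auto simp: Zp_def)
  then obtain n where "n < p ^ k" "absval (r - of_nat n) \<le> (1 / real p) ^ k"
    using rat_near_of_nat[OF p r(1)] by auto
  moreover from this xr have "absval ((x - r) + (r - of_nat n)) \<le> (1 / real p) ^ k"
    by (intro absval_add_le)
  ultimately show ?thesis by auto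
qed

lemma inverse_prime_power_small:
  assumes "prime (p::nat)" "e > 0"
  shows "\<exists>k. (1 / real p) ^ k < e"
  using assms prime_gt_1_nat[OF assms(1)] by (intro real_arch_pow_inv) auto

lemma Zp_nat_sequence:
  fixes x :: "'c::complete_ultrametric_field"
  assumes p: "prime p" "absval (of_nat p :: 'c) = 1 / real p"
    and x: "x \<in> Zp"
  obtains y :: "nat \<Rightarrow> nat" where "(\<lambda>k. of_nat (y k)) \<longlonglongrightarrow> x"
proof -
  have "x \<in> closure (range of_nat)"
    unfolding closure_approachable
  proof (intro allI impI)
    fix e :: real assume "e > 0"
    then obtain k where "(1 / real p) ^ k < e"
      using inverse_prime_power_small[OF p(1)] by blast
    moreover obtain n where "absval (x - of_nat n) \<le> (1 / real p) ^ k"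
      using Zp_near_of_nat[OF p x] by blast
    ultimately show "\<exists>y\<in>range of_nat. dist y x < e"
      by (intro bexI[of _ "of_nat n"]) (auto simp: absval_minus_commute[of _ x] dist_absval)
  qed
  then obtain f where f: "\<forall>n. f n \<in> range of_nat" "f \<longlonglongrightarrow> x"
    unfolding closure_sequential by blast
  then have "\<forall>n. \<exists>m. f n = of_nat m" by blast
  then obtain y where "\<forall>n. f n = of_nat (y n)"
    unfolding choice_iff by blast
  then have "f = (\<lambda>k. of_nat (y k))" by blast
  with f(2) that show ?thesis by simp
qed

lemma compact_Zp:
  assumes p: "prime p" "absval (of_nat p :: 'c::complete_ultrametric_field) = 1 / real p"
  shows "compact (Zp :: 'c set)"
  unfolding compact_eq_totally_bounded
proof (intro conjI allI impI)
  have eq: "Zp = closure \<rat> \<inter> cball (0 :: 'c) 1"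
    by (auto simp: Zp_def Qp_def dist_absval)
  show "complete (Zp :: 'c set)"
    unfolding complete_eq_closed eq by (intro closed_Int closed_cball closed_closure)
next
  fix e :: real assume "e > 0"
  then obtain k where k: "(1 / real p) ^ k < e"
    using inverse_prime_power_small[OF p(1)] by blast
  have "Zp \<subseteq> (\<Union>x\<in>of_nat ` {..<p ^ k}. ball (x :: 'c) e)"
  proof
    fix x :: 'c assume "x \<in> Zp"
    then obtain n where "n < p ^ k" "absval (x - of_nat n) \<le> (1 / real p) ^ k"
      using Zp_near_of_nat[OF p] by blast
    with k show "x \<in> (\<Union>x\<in>of_nat ` {..<p ^ k}. ball (x :: 'c) e)"
      by (auto simp: absval_minus_commute[of _ x] dist_absval intro!: bexI[of _ n])
  qed
  then show "\<exists>K. finite K \<and> (Zp :: 'c set) \<subseteq> (\<Union>x\<in>K. ball x e)"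
    by (intro exI[of _ "of_nat ` {..<p ^ k}"]) auto
qed

section \<open>Mahler expansions\<close>

lemma mahler_basis_of_nat:
  "mahler_basis k (of_nat n) = (of_nat (n choose k) :: 'c::complete_ultrametric_field)"
  by (simp add: mahler_basis_def binomial_gbinomial)

lemma tendsto_mahler_basis [tendsto_intros]:
  fixes f :: "'b \<Rightarrow> 'c::complete_ultrametric_field"
  assumes "(f \<longlongrightarrow> x) F"
  shows "((\<lambda>y. mahler_basis n (f y)) \<longlongrightarrow> mahler_basis n x) F"
  unfolding mahler_basis_def gbinomial_prod_rev divide_inverse
  by (intro tendsto_mult tendsto_const tendsto_prod' tendsto_diff assms)

text \<open>
  The condition that \<open>mahler_coeffs\<close> imposes on its value, named so that existence and uniqueness can be
  stated separately.
\<close>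

definition mahler_expansion ::
    "(nat \<Rightarrow> 'c) \<Rightarrow> ('c::complete_ultrametric_field \<Rightarrow> 'c) \<Rightarrow> bool" where
  "mahler_expansion a \<phi> \<longleftrightarrow> a \<longlonglongrightarrow> 0 \<and> (\<forall>x\<in>Zp. (\<lambda>n. a n * mahler_basis n x) sums \<phi> x)"

lemma mahler_expansion_of_nat:
  fixes a :: "nat \<Rightarrow> 'c::complete_ultrametric_field"
  assumes "mahler_expansion a \<phi>"
  shows "\<phi> (of_nat n) = (\<Sum>k\<le>n. of_nat (n choose k) * a k)"
proof -
  have "(\<lambda>k. a k * mahler_basis k (of_nat n)) sums \<phi> (of_nat n)"
    using assms of_nat_in_Zp by (auto simp: mahler_expansion_def)
  moreover have "(\<lambda>k. a k * mahler_basis k (of_nat n)) sums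
      (\<Sum>k\<le>n. a k * mahler_basis k (of_nat n))"
    by (intro sums_finite) (auto simp: mahler_basis_of_nat)
  ultimately have "\<phi> (of_nat n) = (\<Sum>k\<le>n. a k * mahler_basis k (of_nat n))"
    by (rule sums_unique2)
  then show ?thesis by (simp add: mahler_basis_of_nat mult.commute)
qed

text \<open>
  At \<open>n\<close> the series stops after the term \<open>a n\<close>, which has coefficient \<open>1\<close>; so the values at the natural
  numbers determine the coefficients recursively.
\<close>

lemma mahler_expansion_unique:
  fixes a b :: "nat \<Rightarrow> 'c::complete_ultrametric_field"
  assumes "mahler_expansion a \<phi>" "mahler_expansion b \<phi>"
  shows "a = b"
proof
  fix n show "a n = b n"
  proof (induction n rule: less_induct)
    case (less n)
    have "(\<Sum>k<n. of_nat (n choose k) * a k) + a n = (\<Sum>k<n. of_nat (n choose k) * b k) + b n"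
      using mahler_expansion_of_nat[OF assms(1), of n] mahler_expansion_of_nat[OF assms(2), of n]
      by (simp flip: lessThan_Suc_atMost)
    then show ?case using less by simp
  qed
qed

lemma mahler_coeffs_eqI:
  assumes "mahler_expansion a \<phi>"
  shows "mahler_coeffs \<phi> = a"
  unfolding mahler_coeffs_def mahler_expansion_def[symmetric]
  by (intro the_equality assms) (rule mahler_expansion_unique[OF _ assms])

text \<open>
  Convergence of the coefficients to \<open>0\<close> comes from the almost periodicity of \<open>\<phi>\<close> on the natural numbers.
  For the sum, compare a partial sum with \<open>\<phi>\<close> at natural numbers, where the difference is a finite
  tail bounded by the size of the coefficients in it; the bound is uniform and passes to limits of
  natural numbers.
\<close>

theorem mahler_theorem:
  fixes \<phi> :: "'c::complete_ultrametric_field \<Rightarrow> 'c"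
  assumes p: "prime p" "absval (of_nat p :: 'c) = 1 / real p"
    and cont: "continuous_on Zp \<phi>"
  shows "mahler_expansion (\<lambda>n. (fwd_diff ^^ n) (\<lambda>k. \<phi> (of_nat k)) 0) \<phi>"
proof -
  define g where "g k = \<phi> (of_nat k)" for k
  define a where "a n = (fwd_diff ^^ n) g 0" for n
  have unif: "uniformly_continuous_on Zp \<phi>"
    using compact_uniformly_continuous[OF cont compact_Zp[OF p]] .
  have "bounded (\<phi> ` Zp)"
    using compact_continuous_image[OF cont compact_Zp[OF p]] compact_imp_bounded by blast
  then obtain M where "\<And>x. x \<in> Zp \<Longrightarrow> dist 0 (\<phi> x) \<le> M"
    unfolding bounded_any_center[where a = 0] by blast
  from this[OF of_nat_in_Zp] have M: "absval (g n) \<le> M" for n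
    by (simp add: g_def dist_absval)
  have "\<exists>t. \<forall>n. absval (g (n + p ^ t) - g n) \<le> e" if e: "e > 0" for e
  proof -
    obtain d where d: "d > 0" "\<And>x y. \<lbrakk>x \<in> Zp; y \<in> Zp; dist y x < d\<rbrakk> \<Longrightarrow> dist (\<phi> y) (\<phi> x) < e"
      using unif e unfolding uniformly_continuous_on_def by blast
    obtain t where t: "(1 / real p) ^ t < d"
      using inverse_prime_power_small[OF p(1) d(1)] by blast
    have "absval (g (n + p ^ t) - g n) \<le> e" for n
    proof -
      \<comment> \<open>The two points differ by \<open>p ^ t\<close>, which is small in the field.\<close>
      have "dist (of_nat (n + p ^ t)) (of_nat n :: 'c) < d"
        using t by (simp add: dist_absval absval_power p(2))
      then show ?thesis
        using d(2)[OF of_nat_in_Zp of_nat_in_Zp, of "n + p ^ t" n]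
        unfolding g_def dist_absval by linarith
    qed
    then show ?thesis by blast
  qed
  then have a0: "a \<longlonglongrightarrow> 0"
    unfolding a_def by (rule fwd_diff_funpow_tendsto_0[where g = g, OF p M])
  have "(\<lambda>n. a n * mahler_basis n x) sums \<phi> x" if x: "x \<in> Zp" for x
  proof -
    obtain y :: "nat \<Rightarrow> nat" where y: "(\<lambda>k. of_nat (y k)) \<longlonglongrightarrow> x"
      using Zp_nat_sequence[OF p x] .
    have "(\<lambda>m. (\<Sum>n<m. a n * mahler_basis n x) - \<phi> x) \<longlonglongrightarrow> 0"
      unfolding tendsto_zero_absval_iff
    proof (intro allI impI)
      fix e :: real assume "e > 0"
      then obtain N where N: "\<And>n. n \<ge> N \<Longrightarrow> absval (a n) \<le> e"
        using a0 unfolding tendsto_zero_absval_iff by blast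
      have "absval ((\<Sum>n<m. a n * mahler_basis n x) - \<phi> x) \<le> e" if "m \<ge> N" for m
      proof (rule absval_limit_le)
        show "(\<lambda>k. (\<Sum>n<m. a n * mahler_basis n (of_nat (y k))) - \<phi> (of_nat (y k)))
            \<longlonglongrightarrow> (\<Sum>n<m. a n * mahler_basis n x) - \<phi> x"
          by (intro tendsto_diff tendsto_sum tendsto_mult tendsto_const tendsto_mahler_basis y
              continuous_on_tendsto_compose[OF cont y x]) (simp add: of_nat_in_Zp)
      next
        fix k
        let ?f = "\<lambda>n. a n * of_nat (y k choose n)"
        have "\<phi> (of_nat (y k)) = (\<Sum>n\<le>y k. ?f n)"
          using newton_forward_difference[of g 0 "y k"] by (simp add: g_def a_def mult.commute)
        \<comment> \<open>Padding with vanishing terms lets the first \<open>m\<close> terms be split off even if \<open>m > y k\<close>.\<close>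
        also have "\<dots> = (\<Sum>n<m + Suc (y k). ?f n)"
          by (intro sum.mono_neutral_left) auto
        also have "\<dots> = (\<Sum>n<m. ?f n) + (\<Sum>n\<in>{m..<m + Suc (y k)}. ?f n)"
          using sum.atLeastLessThan_concat[of 0 m "m + Suc (y k)" ?f] by (simp only: lessThan_atLeast0)
        finally have "(\<Sum>n<m. a n * mahler_basis n (of_nat (y k))) - \<phi> (of_nat (y k))
            = - (\<Sum>n\<in>{m..<m + Suc (y k)}. ?f n)"
          by (simp add: mahler_basis_of_nat)
        also have "absval \<dots> \<le> e"
          unfolding absval_minus mult.commute[of "a _"] using \<open>e > 0\<close> \<open>m \<ge> N\<close> N
          by (intro absval_sum_le absval_mult_le absval_of_nat_le_1) auto
        finally show "absval ((\<Sum>n<m. a n * mahler_basis n (of_nat (y k))) - \<phi> (of_nat (y k))) \<le> e" .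
      qed
      then show "\<exists>N. \<forall>m\<ge>N. absval ((\<Sum>n<m. a n * mahler_basis n x) - \<phi> x) \<le> e" by blast
    qed
    from tendsto_add[OF this tendsto_const[of "\<phi> x"]] show ?thesis
      by (simp add: sums_def)
  qed
  with a0 show ?thesis unfolding mahler_expansion_def a_def g_def by blast
qed

section \<open>The operator in Mahler coordinates\<close>

text \<open>
  The effect of \<open>\<phi>(x) \<mapsto> x \<phi>(x - 1)\<close> on Mahler coefficients. At \<open>n = 0\<close> the factor \<open>of_nat n\<close> cancels the
  truncated index \<open>n - 1\<close>.
\<close>

definition shift_coeffs :: "(nat \<Rightarrow> 'a::comm_ring_1) \<Rightarrow> nat \<Rightarrow> 'a" where
  "shift_coeffs a n = of_nat n * a (n - 1)"

text \<open>
  Absorption turns \<open>x * mahler_basis n (x - 1)\<close> into a multiple of the next basis function, so the new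
  series is the old one reindexed. Its coefficients still tend to \<open>0\<close> because integers have absolute
  value at most \<open>1\<close>.
\<close>

lemma mahler_expansion_S_op:
  fixes \<phi> :: "'c::complete_ultrametric_field \<Rightarrow> 'c"
  assumes "mahler_expansion a \<phi>"
  shows "mahler_expansion (\<lambda>n. a n - shift_coeffs a n) (S_op \<phi>)"
  unfolding mahler_expansion_def
proof (intro conjI ballI)
  have a0: "a \<longlonglongrightarrow> 0" using assms by (simp add: mahler_expansion_def)
  have "shift_coeffs a \<longlonglongrightarrow> 0"
    unfolding tendsto_zero_absval_iff
  proof (intro allI impI)
    fix e :: real assume "e > 0"
    then obtain N where N: "\<And>n. n \<ge> N \<Longrightarrow> absval (a n) \<le> e"
      using a0 unfolding tendsto_zero_absval_iff by blast
    then have "absval (shift_coeffs a n) \<le> e" if "n \<ge> Suc N" for n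
      using that unfolding shift_coeffs_def by (intro absval_mult_le absval_of_nat_le_1) auto
    then show "\<exists>N. \<forall>n\<ge>N. absval (shift_coeffs a n) \<le> e" by blast
  qed
  with a0 show "(\<lambda>n. a n - shift_coeffs a n) \<longlonglongrightarrow> 0"
    using tendsto_diff by fastforce
next
  fix x :: 'c assume x: "x \<in> Zp"
  have s: "(\<lambda>n. a n * mahler_basis n x) sums \<phi> x"
    and s1: "(\<lambda>n. a n * mahler_basis n (x - 1)) sums \<phi> (x - 1)"
    using assms x Zp_minus_1[OF x] by (auto simp: mahler_expansion_def)
  have "(\<lambda>n. x * (a n * mahler_basis n (x - 1))) sums (x * \<phi> (x - 1))"
    using s1 unfolding sums_def sum_distrib_left[symmetric] by (intro tendsto_intros)
  moreover have "x * (a n * mahler_basis n (x - 1))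
      = shift_coeffs a (Suc n) * mahler_basis (Suc n) x" for n
  proof -
    have "x * (a n * mahler_basis n (x - 1)) = a n * (x * (x - 1 gchoose n))"
      by (simp add: mahler_basis_def)
    also have "\<dots> = a n * (of_nat (Suc n) * (x gchoose Suc n))"
      by (simp only: gbinomial_absorption)
    finally show ?thesis
      by (simp add: shift_coeffs_def mahler_basis_def del: of_nat_Suc)
  qed
  ultimately have "(\<lambda>n. shift_coeffs a (Suc n) * mahler_basis (Suc n) x) sums (x * \<phi> (x - 1))"
    by simp
  then have "(\<lambda>n. shift_coeffs a n * mahler_basis n x) sums (x * \<phi> (x - 1))"
    using sums_Suc[of "\<lambda>n. shift_coeffs a n * mahler_basis n x"] by (simp add: shift_coeffs_def)
  then have "(\<lambda>n. (a n - shift_coeffs a n) * mahler_basis n x) sums (\<phi> x - x * \<phi> (x - 1))"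
    using s unfolding sums_def left_diff_distrib sum_subtractf by (intro tendsto_diff)
  with x show "(\<lambda>n. (a n - shift_coeffs a n) * mahler_basis n x) sums S_op \<phi> x"
    by (simp add: S_op_def)
qed

definition binomial_convolution :: "(nat \<Rightarrow> 'a::comm_ring_1) \<Rightarrow> (nat \<Rightarrow> 'a) \<Rightarrow> nat \<Rightarrow> 'a" where
  "binomial_convolution a b n = (\<Sum>k\<le>n. of_nat (n choose k) * a k * b (n - k))"

lemma binomial_convolution_commute: "binomial_convolution a b n = binomial_convolution b a n"
  unfolding binomial_convolution_def
  by (rule sum.reindex_bij_witness[where i = "\<lambda>k. n - k" and j = "\<lambda>k. n - k"])
    (auto simp: binomial_symmetric[symmetric] algebra_simps)

text \<open>
  The right-hand side is again a shift, now of the whole convolution, so it is symmetric in \<open>a\<close> and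
  \<open>b\<close>. The reason is the absorption identity for \<open>n choose k\<close>.
\<close>

lemma binomial_convolution_shift_left:
  "binomial_convolution (shift_coeffs a) b n = of_nat n * binomial_convolution a b (n - 1)"
proof (cases n)
  case (Suc m)
  have "of_nat (Suc m choose Suc k) * (of_nat (Suc k) * a k)
      = of_nat (Suc m) * (of_nat (m choose k) * a k)" for k
  proof -
    have "of_nat (Suc k) * of_nat (Suc m choose Suc k)
        = (of_nat (Suc m) * of_nat (m choose k) :: 'a)"
      by (simp only: Suc_times_binomial_eq flip: of_nat_mult)
        (simp only: mult.commute)
    then show ?thesis by (metis mult.assoc mult.commute)
  qed
  then show ?thesis
    unfolding Suc binomial_convolution_def
    by (subst sum.atMost_Suc_shift)
      (simp add: shift_coeffs_def sum_distrib_left mult.assoc del: of_nat_Suc binomial_Suc_Suc)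
qed (simp add: binomial_convolution_def shift_coeffs_def)

text \<open>
  Both sides equal the convolution of \<open>a\<close> and \<open>b\<close> minus its shift.
\<close>

lemma binomial_convolution_S_op_coeffs:
  "binomial_convolution (\<lambda>n. a n - shift_coeffs a n) b n
    = binomial_convolution a (\<lambda>n. b n - shift_coeffs b n) n"
proof -
  have l: "binomial_convolution (\<lambda>n. c n - shift_coeffs c n) d n
      = binomial_convolution c d n - of_nat n * binomial_convolution c d (n - 1)"
    for c d :: "nat \<Rightarrow> 'a"
    unfolding binomial_convolution_shift_left[symmetric]
    by (simp add: binomial_convolution_def algebra_simps sum_subtractf)
  show ?thesis
    by (subst (2) binomial_convolution_commute) (simp add: l binomial_convolution_commute[of b a])
qed

theorem theorem5p4:
  fixes p :: nat
    and \<phi> \<psi> :: "'c::complete_ultrametric_field \<Rightarrow> 'c"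
  assumes "prime p"
    and "is_Cp p TYPE('c)"
    and "\<phi> \<in> C_Zp"
    and "\<psi> \<in> C_Zp"
  shows "S_op \<phi> \<star> \<psi> = \<phi> \<star> S_op \<psi>"
proof -
  have p: "absval (of_nat p :: 'c) = 1 / real p"
    using assms(2) by (simp add: is_Cp_def)
  obtain a b where a: "mahler_expansion a \<phi>" and b: "mahler_expansion b \<psi>"
    using mahler_theorem[OF assms(1) p] assms(3,4) unfolding C_Zp_def by blast
  have "(\<lambda>n. binomial_convolution (mahler_coeffs (S_op \<phi>)) (mahler_coeffs \<psi>) n)
      = (\<lambda>n. binomial_convolution (mahler_coeffs \<phi>) (mahler_coeffs (S_op \<psi>)) n)"
    unfolding mahler_coeffs_eqI[OF a] mahler_coeffs_eqI[OF b]
      mahler_coeffs_eqI[OF mahler_expansion_S_op[OF a]]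
      mahler_coeffs_eqI[OF mahler_expansion_S_op[OF b]]
    by (simp only: binomial_convolution_S_op_coeffs)
  then show ?thesis
    unfolding convolution_def binomial_convolution_def by metis
qed

end
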